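(* Let a strict complete stable marriage instance of size $n$ be given, and let $S_m$ be a set of men and $S_w$ a set of women. Suppose the men of $S_m$ have pairwise distinct worst women, all outside $S_w$, and the women of $S_w$ have pairwise distinct worst men, all outside $S_m$. Then conditions (H1) and (H2) (defined in the context) hold for $(S_m,S_w)$.
   Context: In an instance of size $n$ there are $n$ men and $n$ women, each with a strict complete preference order on the other side; $r_M(i,j)\in\{1,\dots,n\}$ is the rank of woman $j$ in man $i$'s list and $r_W(j,i)\in\{1,\dots,n\}$ the rank of man $i$ in woman $j$'s list (1 is best, $n$ is worst). Let $T_w$ be the set of women not in $S_w$ and $T_m$ the set of men not in $S_m$. The maximum over an empty set of ranks is read as $0$. (H1): the bipartite graph on $(S_m,T_w)$ with $i\sim w$ iff $r_M(i,w)>\max_{j\in S_w}r_M(i,j)$ has a matching saturating $S_m$. (H2): the bipartite graph on $(S_w,T_m)$ with $j\sim i'$ iff $r_W(j,i')>\max_{i\in S_m}r_W(j,i)$ has a matching saturating $S_w$. *)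

theory Defs
  imports Main
begin

text \<open>
  Men and women are the elements of finite sets \<open>M\<close> and \<open>W\<close> of size \<open>n\<close>, possibly of different
  types. \<open>(j, k) \<in> PM i\<close> means that man \<open>i\<close> strictly prefers woman \<open>j\<close> to woman \<open>k\<close>; likewise
  \<open>PW\<close> for the women.
\<close>

definition sm_instance ::
  "nat \<Rightarrow> 'm set \<Rightarrow> 'w set \<Rightarrow> ('m \<Rightarrow> 'w rel) \<Rightarrow> ('w \<Rightarrow> 'm rel) \<Rightarrow> bool" where
  "sm_instance n M W PM PW \<longleftrightarrow>
     finite M \<and> finite W \<and> card M = n \<and> card W = n \<and>
     (\<forall>i\<in>M. PM i \<subseteq> W \<times> W \<and> strict_linear_order_on W (PM i)) \<and>
     (\<forall>j\<in>W. PW j \<subseteq> M \<times> M \<and> strict_linear_order_on M (PW j))"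

text \<open>The best element of \<open>A\<close> has rank 1, the worst has rank \<open>card A\<close>.\<close>

definition rank :: "'a set \<Rightarrow> 'a rel \<Rightarrow> 'a \<Rightarrow> nat" where
  "rank A P x = Suc (card {y \<in> A. (y, x) \<in> P})"

definition worst :: "'a set \<Rightarrow> 'a rel \<Rightarrow> 'a" where
  "worst A P = (THE x. x \<in> A \<and> rank A P x = card A)"

definition max_rank :: "'a set \<Rightarrow> 'a rel \<Rightarrow> 'a set \<Rightarrow> nat" where
  "max_rank A P S = (if S = {} then 0 else Max (rank A P ` S))"

text \<open>
  A bipartite graph is given by its set of edges, oriented from the left to the right side.
  Thus \<open>inj_on fst\<close> and \<open>inj_on snd\<close> say that distinct edges of the matching share neither a left
  nor a right endpoint.
\<close>

definition matching :: "('a \<times> 'b) set \<Rightarrow> ('a \<times> 'b) set \<Rightarrow> bool" where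
  "matching E N \<longleftrightarrow> N \<subseteq> E \<and> inj_on fst N \<and> inj_on snd N"

definition has_saturating_matching :: "'a set \<Rightarrow> ('a \<times> 'b) set \<Rightarrow> bool" where
  "has_saturating_matching S E \<longleftrightarrow> (\<exists>N. matching E N \<and> S \<subseteq> fst ` N)"

definition H1 :: "'w set \<Rightarrow> ('m \<Rightarrow> 'w rel) \<Rightarrow> 'm set \<Rightarrow> 'w set \<Rightarrow> bool" where
  "H1 W PM Sm Sw \<longleftrightarrow>
     has_saturating_matching Sm
       {(i, w). i \<in> Sm \<and> w \<in> W - Sw \<and> rank W (PM i) w > max_rank W (PM i) Sw}"

definition H2 :: "'m set \<Rightarrow> ('w \<Rightarrow> 'm rel) \<Rightarrow> 'm set \<Rightarrow> 'w set \<Rightarrow> bool" where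
  "H2 M PW Sm Sw \<longleftrightarrow>
     has_saturating_matching Sw
       {(j, i'). j \<in> Sw \<and> i' \<in> M - Sm \<and> rank M (PW j) i' > max_rank M (PW j) Sm}"

end

theory Submission
  imports Defs
begin

text \<open>Match every man of \<open>Sm\<close> with his worst woman. She has rank
  \<open>card W\<close>, the largest possible, and ranks are injective, so every woman of
  \<open>Sw\<close>, being different from her, has a strictly smaller rank: the pair is an edge of
  the (H1) graph (\<open>max_rank_less_rank_worst\<close>). Distinctness of the worst women makes
  these edges a matching (\<open>has_saturating_matching_if_inj_on\<close>). (H2) is the same
  argument with the sexes exchanged.\<close>

lemma rank_less:
  assumes "finite A" "strict_linear_order_on A P" "x \<in> A" "(x, y) \<in> P"
  shows "rank A P x < rank A P y"
proof -
  have "trans P" "irrefl P"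
    using assms(2) by (auto simp: strict_linear_order_on_def)
  \<comment> \<open>Transitivity gives the inclusion; \<open>x\<close> itself witnesses strictness,
    by irreflexivity.\<close>
  then have "{z \<in> A. (z, x) \<in> P} \<subset> {z \<in> A. (z, y) \<in> P}"
    using assms(3,4) by (auto simp: irrefl_def dest: transD)
  then show ?thesis
    using assms(1) by (simp add: rank_def psubset_card_mono)
qed

text \<open>Totality and \<open>rank_less\<close> give injectivity; no element precedes itself, so
  ranks are at most \<open>card A\<close>; counting then gives surjectivity.\<close>

lemma bij_betw_rank:
  assumes "finite A" "strict_linear_order_on A P"
  shows "bij_betw (rank A P) A {1..card A}"
proof -
  have "total_on A P" "irrefl P"
    using assms(2) by (auto simp: strict_linear_order_on_def)
  have inj: "inj_on (rank A P) A"
  proof (rule inj_onI, rule ccontr)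
    fix x y assume "x \<in> A" "y \<in> A" "rank A P x = rank A P y" "x \<noteq> y"
    then show False
      using \<open>total_on A P\<close> rank_less[OF assms, of x y] rank_less[OF assms, of y x]
      by (auto simp: total_on_def)
  qed
  have "rank A P ` A \<subseteq> {1..card A}"
  proof (clarsimp simp: rank_def Suc_le_eq)
    fix x assume "x \<in> A"
    then have "{y \<in> A. (y, x) \<in> P} \<subset> A"
      using \<open>irrefl P\<close> by (auto simp: irrefl_def)
    then show "card {y \<in> A. (y, x) \<in> P} < card A"
      using assms(1) by (simp add: psubset_card_mono)
  qed
  moreover have "card (rank A P ` A) = card {1..card A}"
    using inj by (simp add: card_image)
  ultimately have "rank A P ` A = {1..card A}"
    by (intro card_subset_eq) auto
  with inj show ?thesis
    by (simp add: bij_betw_def)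
qed

text \<open>Justifies the definite description in \<open>worst\<close>: for nonempty
  \<open>A\<close>, surjectivity of the rank gives existence and injectivity gives
  uniqueness.\<close>

lemma worst_in_and_rank_worst:
  assumes "finite A" "A \<noteq> {}" "strict_linear_order_on A P"
  shows "worst A P \<in> A \<and> rank A P (worst A P) = card A"
proof -
  note bij = bij_betw_rank[OF assms(1,3)]
  have "card A \<in> {1..card A}"
    using assms(1,2) by (simp add: Suc_le_eq card_gt_0_iff)
  then have "card A \<in> rank A P ` A"
    using bij_betw_imp_surj_on[OF bij] by simp
  then obtain x where "x \<in> A" "rank A P x = card A"
    by force
  then have "\<exists>!x. x \<in> A \<and> rank A P x = card A"
    using bij_betw_imp_inj_on[OF bij] by (metis inj_onD)
  then show ?thesis
    unfolding worst_def by (rule theI')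
qed

lemma max_rank_less_rank_worst:
  assumes "finite A" "A \<noteq> {}" "strict_linear_order_on A P"
    and "S \<subseteq> A" "worst A P \<notin> S"
  shows "max_rank A P S < rank A P (worst A P)"
proof -
  note worst = worst_in_and_rank_worst[OF assms(1-3)]
  have "rank A P y < rank A P (worst A P)" if "y \<in> S" for y
  proof -
    have "rank A P y \<le> card A"
      using bij_betwE[OF bij_betw_rank[OF assms(1,3)]] that assms(4) by auto
    moreover have "rank A P y \<noteq> rank A P (worst A P)"
      using inj_onD[OF bij_betw_imp_inj_on[OF bij_betw_rank[OF assms(1,3)]], of y "worst A P"]
        worst that assms(4,5) by auto
    ultimately show ?thesis
      using worst by simp
  qed
  moreover have "finite S"
    using assms(1,4) by (rule finite_subset[rotated])
  \<comment> \<open>For empty \<open>S\<close> the maximum is 0 by convention, still below any rank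
    since ranks start at 1.\<close>
  ultimately show ?thesis
    by (auto simp: max_rank_def rank_def)
qed

text \<open>The matching is the graph of \<open>f\<close> on \<open>S\<close>.\<close>

lemma has_saturating_matching_if_inj_on:
  assumes "inj_on f S" "\<And>x. x \<in> S \<Longrightarrow> (x, f x) \<in> E"
  shows "has_saturating_matching S E"
  unfolding has_saturating_matching_def matching_def
  using assms by (intro exI[of _ "(\<lambda>x. (x, f x)) ` S"]) (force simp: inj_on_def)

text \<open>The set of all men does not occur, so that \<open>W\<close> is nonempty whenever a worst
  woman is used has to be assumed.\<close>

lemma H1_if_inj_on_worst:
  assumes "finite W" "Sm \<noteq> {} \<Longrightarrow> W \<noteq> {}" "Sw \<subseteq> W"
    and "\<And>i. i \<in> Sm \<Longrightarrow> strict_linear_order_on W (PM i)"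
    and "inj_on (\<lambda>i. worst W (PM i)) Sm"
    and "\<And>i. i \<in> Sm \<Longrightarrow> worst W (PM i) \<notin> Sw"
  shows "H1 W PM Sm Sw"
  unfolding H1_def
proof (rule has_saturating_matching_if_inj_on[OF assms(5)])
  fix i assume i: "i \<in> Sm"
  then have "W \<noteq> {}"
    using assms(2) by blast
  with i show "(i, worst W (PM i)) \<in>
    {(i, w). i \<in> Sm \<and> w \<in> W - Sw \<and> rank W (PM i) w > max_rank W (PM i) Sw}"
    using assms worst_in_and_rank_worst[of W "PM i"] max_rank_less_rank_worst[of W "PM i" Sw]
    by auto
qed

lemma H2_eq_H1: "H2 M PW Sm Sw = H1 M PW Sw Sm"
  by (simp add: H1_def H2_def)

theorem lemma6p5:
  fixes n :: nat
    and M :: "'m set" and W :: "'w set"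
    and PM :: "'m \<Rightarrow> 'w rel" and PW :: "'w \<Rightarrow> 'm rel"
    and Sm :: "'m set" and Sw :: "'w set"
  assumes "sm_instance n M W PM PW"
    and "Sm \<subseteq> M" and "Sw \<subseteq> W"
    and "inj_on (\<lambda>i. worst W (PM i)) Sm"
    and "\<forall>i\<in>Sm. worst W (PM i) \<notin> Sw"
    and "inj_on (\<lambda>j. worst M (PW j)) Sw"
    and "\<forall>j\<in>Sw. worst M (PW j) \<notin> Sm"
  shows "H1 W PM Sm Sw \<and> H2 M PW Sm Sw"
proof -
  have fin: "finite M" "finite W" and "card M = card W"
    and PM: "\<And>i. i \<in> M \<Longrightarrow> strict_linear_order_on W (PM i)"
    and PW: "\<And>j. j \<in> W \<Longrightarrow> strict_linear_order_on M (PW j)"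
    using assms(1) by (auto simp: sm_instance_def)
  \<comment> \<open>Equal sizes supply that nonemptiness assumption in both directions.\<close>
  then have "M = {} \<longleftrightarrow> W = {}"
    by (metis card_0_eq)
  then have "H1 W PM Sm Sw" "H1 M PW Sw Sm"
    using assms(2-7) fin PM PW by (auto intro!: H1_if_inj_on_worst)
  then show ?thesis
    by (simp add: H2_eq_H1)
qed

end
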